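(* Let $N\in\mathbb{N}$, $\alpha<-N$ and $c>0$. Let $P_n^{(2,0)}$, $0\le n\le N$, be the monic orthogonal polynomials with respect to the weight $$\rho(x)=(\alpha)_x(-N)_x\frac{c^x}{x!},\qquad x\in\{0,1,\dots,N\}$$ (generalized Krawtchouk polynomials). For $\beta>0$ let $P_{n,\beta}^{(2,1)}$, $0\le n\le N$, be the monic orthogonal polynomials with respect to the weight $$\rho_\beta(x)=\frac{(\alpha)_x(-N)_x}{(\beta+1)_x}\frac{(c\beta)^x}{x!},\qquad x\in\{0,1,\dots,N\}$$ (generalized Hahn polynomials of type I with parameters $\alpha,-N,\beta$ and $c\beta$). Then for every $0\le n\le N$ and every $x$, $$\lim_{\beta\to\infty}P_{n,\beta}^{(2,1)}(x)=P_n^{(2,0)}(x).$$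
   Context: $(a)_x=a(a+1)\cdots(a+x-1)$, $(a)_0=1$, is the Pochhammer symbol. Given a positive weight $\rho$ on a finite set $S\subset\mathbb{R}$, the monic orthogonal polynomials $P_n$ with respect to $\rho$ are the monic polynomials of degree $n$ ($0\le n<|S|$) satisfying $\sum_{x\in S}P_n(x)x^k\rho(x)=0$ for $0\le k<n$. *)

theory Defs
  imports Complex_Main "HOL-Computational_Algebra.Polynomial"
begin

text \<open>
  \<open>P\<close> is the monic polynomial of degree \<open>n\<close> orthogonal with respect to the weight \<open>\<rho>\<close> on the
  finite set \<open>S\<close> of nodes. The nodes are natural numbers regarded as reals, so that the weight
  can be a function of \<open>nat\<close> and Pochhammer symbols can be indexed by the node.
\<close>
definition monic_orthogonal_poly :: "nat set \<Rightarrow> (nat \<Rightarrow> real) \<Rightarrow> nat \<Rightarrow> real poly \<Rightarrow> bool" where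
  "monic_orthogonal_poly S \<rho> n P \<longleftrightarrow>
     degree P = n \<and> lead_coeff P = 1 \<and>
     (\<forall>k<n. (\<Sum>x\<in>S. poly P (real x) * real x ^ k * \<rho> x) = 0)"

definition gen_krawtchouk_weight :: "real \<Rightarrow> real \<Rightarrow> real \<Rightarrow> nat \<Rightarrow> real" where
  "gen_krawtchouk_weight a b c x = pochhammer a x * pochhammer b x * (c ^ x / fact x)"

definition gen_hahn_weight :: "real \<Rightarrow> real \<Rightarrow> real \<Rightarrow> real \<Rightarrow> nat \<Rightarrow> real" where
  "gen_hahn_weight a b \<beta> c x =
     pochhammer a x * pochhammer b x / pochhammer (\<beta> + 1) x * (c ^ x / fact x)"

end

(*  The difference D of the monic orthogonal polynomials Q and P for two weights v and w has degree
    less than n, so it is orthogonal to Q under v and to P under w. Hence the v-norm satisfies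
    sum D^2 v = - sum P D (v - w), and AM-GM bounds D at the nodes by P^2 (v - w)^2 / w. Thus
    convergence of the weights forces convergence of the polynomials at the nodes, and at every
    other point by Lagrange interpolation.  *)
theory Submission
  imports Defs "HOL-Real_Asymp.Real_Asymp"
begin

text \<open>Linearity extends orthogonality from the powers below \<open>n\<close> to
  \<open>D\<close>. The degree bound is phrased through coefficients because
  \<open>degree D < n\<close> would rule out \<open>D = 0\<close> when \<open>n = 0\<close>.\<close>

lemma monic_orthogonal_poly_sum_eq_0:
  assumes "monic_orthogonal_poly S \<rho> n P" and "\<And>i. i \<ge> n \<Longrightarrow> coeff D i = 0"
  shows "(\<Sum>x\<in>S. poly P (real x) * poly D (real x) * \<rho> x) = 0"
proof -
  have D: "poly D y = (\<Sum>k<n. coeff D k * y ^ k)" for y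
    unfolding poly_altdef using assms(2) by (intro sum.mono_neutral_cong) (auto simp: coeff_eq_0)
  have "(\<Sum>x\<in>S. poly P (real x) * poly D (real x) * \<rho> x)
      = (\<Sum>x\<in>S. \<Sum>k<n. coeff D k * (poly P (real x) * real x ^ k * \<rho> x))"
    by (simp add: D sum_distrib_left sum_distrib_right mult_ac)
  also have "\<dots> = (\<Sum>k<n. coeff D k * (\<Sum>x\<in>S. poly P (real x) * real x ^ k * \<rho> x))"
    by (subst sum.swap) (simp add: sum_distrib_left)
  also have "\<dots> = 0"
    using assms(1) by (simp add: monic_orthogonal_poly_def)
  finally show ?thesis .
qed

lemma coeff_diff_monic_orthogonal_poly:
  assumes "monic_orthogonal_poly S v n Q" "monic_orthogonal_poly S w n P" "i \<ge> n"
  shows "coeff (Q - P) i = 0"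
  using assms by (cases "i = n") (auto simp: monic_orthogonal_poly_def coeff_eq_0)

lemma monic_orthogonal_poly_perturbation:
  assumes "finite S"
    and Q: "monic_orthogonal_poly S v n Q" and P: "monic_orthogonal_poly S w n P"
    and pos: "\<And>x. x \<in> S \<Longrightarrow> w x > 0" and close: "\<And>x. x \<in> S \<Longrightarrow> v x \<ge> w x / 2"
    and "y \<in> S"
  shows "(poly (Q - P) (real y))\<^sup>2 * (w y / 4) \<le> (\<Sum>x\<in>S. (poly P (real x))\<^sup>2 * (v x - w x)\<^sup>2 / w x)"
proof -
  define d where "d x = poly (Q - P) (real x)" for x
  define p where "p x = poly P (real x)" for x
  have "(\<Sum>x\<in>S. poly Q (real x) * d x * v x) = 0" "(\<Sum>x\<in>S. p x * d x * w x) = 0"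
    unfolding d_def p_def
    by (intro monic_orthogonal_poly_sum_eq_0[OF Q] monic_orthogonal_poly_sum_eq_0[OF P]
          coeff_diff_monic_orthogonal_poly[OF Q P]; assumption)+
  \<comment> \<open>Difference of the two relations, with \<open>Q = P + d\<close> at the
    nodes.\<close>
  then have "(\<Sum>x\<in>S. (d x)\<^sup>2 * v x + p x * d x * (v x - w x)) = 0"
    by (simp add: d_def p_def power2_eq_square algebra_simps sum.distrib sum_subtractf)
  moreover have "(d x)\<^sup>2 * (w x / 4) - (p x)\<^sup>2 * (v x - w x)\<^sup>2 / w x
      \<le> (d x)\<^sup>2 * v x + p x * d x * (v x - w x)" if "x \<in> S" for x
  proof -
    \<comment> \<open>This square is AM-GM weighted so that the cross term costs only
      \<open>w x / 4\<close> of the coefficient \<open>v x \<ge> w x / 2\<close> of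
      \<open>(d x)\<^sup>2\<close>; the other \<open>w x / 4\<close> survives.\<close>
    have "0 \<le> (d x * (w x / 2) + p x * (v x - w x))\<^sup>2 / w x"
      using pos[OF that] by simp
    also have "\<dots> = (d x)\<^sup>2 * (w x / 4) + p x * d x * (v x - w x) + (p x)\<^sup>2 * (v x - w x)\<^sup>2 / w x"
      using pos[OF that] by (simp add: field_simps power2_eq_square)
    finally show ?thesis
      using mult_left_mono[OF close[OF that], of "(d x)\<^sup>2"] by simp
  qed
  ultimately have "(\<Sum>x\<in>S. (d x)\<^sup>2 * (w x / 4) - (p x)\<^sup>2 * (v x - w x)\<^sup>2 / w x) \<le> 0"
    by (metis (mono_tags, lifting) sum_mono)
  moreover have "(d y)\<^sup>2 * (w y / 4) \<le> (\<Sum>x\<in>S. (d x)\<^sup>2 * (w x / 4))"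
    using \<open>finite S\<close> \<open>y \<in> S\<close> pos by (intro member_le_sum) (auto simp: less_imp_le)
  ultimately show ?thesis
    by (simp add: sum_subtractf d_def p_def)
qed

text \<open>The basis \<open>L\<close> is fixed before \<open>p\<close>, so one basis serves a whole
  family of polynomials and limits pass through the sum.\<close>

lemma lagrange_interpolation:
  fixes A :: "'a :: field_char_0 set"
  assumes "finite A"
  obtains L :: "'a \<Rightarrow> 'a poly"
  where "\<And>p. degree p < card A \<Longrightarrow> p = (\<Sum>a\<in>A. smult (poly p a) (L a))"
proof
  define L where "L a = (\<Prod>b\<in>A - {a}. smult (inverse (a - b)) [:- b, 1:])" for a :: 'a
  have "poly (L a) c = (\<Prod>b\<in>A - {a}. (c - b) / (a - b))" for a c
    by (simp add: L_def poly_prod divide_inverse algebra_simps)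
  then have L: "poly (L a) b = (if a = b then 1 else 0)" if "a \<in> A" "b \<in> A" for a b
    using that assms by (auto intro!: prod.neutral)
  have deg_L: "degree (L a) \<le> card A - 1" if "a \<in> A" for a
  proof -
    have "degree (L a) \<le> (\<Sum>b\<in>A - {a}. degree (smult (inverse (a - b)) [:- b, 1:]))"
      unfolding L_def using assms by (intro degree_prod_sum_le[unfolded o_def]) auto
    also have "\<dots> \<le> (\<Sum>b\<in>A - {a}. 1)"
      by (intro sum_mono order.trans[OF degree_smult_le]) simp
    also have "\<dots> = card A - 1" using assms that by simp
    finally show ?thesis .
  qed
  fix p :: "'a poly"
  assume "degree p < card A"
  then show "p = (\<Sum>a\<in>A. smult (poly p a) (L a))"
  proof (intro poly_eqI_degree[of A])
    fix b assume "b \<in> A"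
    then show "poly p b = poly (\<Sum>a\<in>A. smult (poly p a) (L a)) b"
      using assms by (simp add: poly_sum L if_distrib sum.delta cong: sum.cong if_cong)
  next
    \<comment> \<open>The truncated subtraction is harmless: \<open>degree p < card A\<close> forces
      \<open>card A > 0\<close>.\<close>
    have "degree (\<Sum>a\<in>A. smult (poly p a) (L a)) \<le> card A - 1"
      using assms deg_L by (intro degree_sum_le order.trans[OF degree_smult_le]) auto
    with \<open>degree p < card A\<close> show "degree (\<Sum>a\<in>A. smult (poly p a) (L a)) < card A" by simp
  qed
qed

theorem tendsto_monic_orthogonal_poly:
  assumes "finite S" "n < card S"
    and pos: "\<And>y. y \<in> S \<Longrightarrow> w y > 0"
    and lim: "\<And>y. y \<in> S \<Longrightarrow> ((\<lambda>\<beta>. v \<beta> y) \<longlongrightarrow> w y) F"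
    and P: "monic_orthogonal_poly S w n P"
    and Q: "\<forall>\<^sub>F \<beta> in F. monic_orthogonal_poly S (v \<beta>) n (Q \<beta>)"
  shows "((\<lambda>\<beta>. poly (Q \<beta>) x) \<longlongrightarrow> poly P x) F"
proof -
  \<comment> \<open>Positivity gives \<open>w y / 2 < w y\<close>, and finitely many nodes allow one
    common eventuality.\<close>
  have close: "\<forall>\<^sub>F \<beta> in F. \<forall>y\<in>S. v \<beta> y > w y / 2"
    using assms(1) pos by (intro eventually_ball_finite ballI order_tendstoD(1)[OF lim]) auto
  have node: "((\<lambda>\<beta>. poly (Q \<beta> - P) (real y)) \<longlongrightarrow> 0) F" if y: "y \<in> S" for y
  proof -
    \<comment> \<open>The perturbation bound solved for the squared difference; it involves
      \<open>P\<close> and the weights but not \<open>Q\<close>, hence its limit is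
      computable.\<close>
    let ?B = "\<lambda>\<beta>. (\<Sum>x\<in>S. (poly P (real x))\<^sup>2 * (v \<beta> x - w x)\<^sup>2 / w x) / (w y / 4)"
    have "(?B \<longlongrightarrow> (\<Sum>x\<in>S. (poly P (real x))\<^sup>2 * (w x - w x)\<^sup>2 / w x) / (w y / 4)) F"
      using pos y by (intro tendsto_intros lim) (auto simp: less_imp_neq[symmetric])
    then have B: "(?B \<longlongrightarrow> 0) F" by simp
    have "\<forall>\<^sub>F \<beta> in F. (poly (Q \<beta> - P) (real y))\<^sup>2 \<le> ?B \<beta>"
      using Q close
    proof eventually_elim
      case (elim \<beta>)
      then show ?case
        using monic_orthogonal_poly_perturbation[OF assms(1) elim(1) P pos _ y] pos[OF y]
        by (subst pos_le_divide_eq) (auto simp: less_imp_le)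
    qed
    then have "((\<lambda>\<beta>. (poly (Q \<beta> - P) (real y))\<^sup>2) \<longlongrightarrow> 0) F"
      by (intro tendsto_sandwich[OF _ _ tendsto_const B]) auto
    then show ?thesis by simp
  qed
  obtain L :: "real \<Rightarrow> real poly"
    where L: "\<And>p. degree p < card (real ` S) \<Longrightarrow> p = (\<Sum>a\<in>real ` S. smult (poly p a) (L a))"
    using lagrange_interpolation[of "real ` S"] assms(1) by blast
  \<comment> \<open>The degree is at most \<open>n < card S\<close>, so the node values determine
    the difference everywhere.\<close>
  have "\<forall>\<^sub>F \<beta> in F. (\<Sum>y\<in>real ` S. poly (Q \<beta> - P) y * poly (L y) x) = poly (Q \<beta> - P) x"
    using Q
  proof eventually_elim
    case (elim \<beta>)
    then have "degree (Q \<beta> - P) \<le> n"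
      using P by (intro degree_diff_le) (auto simp: monic_orthogonal_poly_def)
    then have "degree (Q \<beta> - P) < card (real ` S)"
      using assms(2) by (simp add: card_image inj_on_def)
    from arg_cong[OF L[OF this], of "\<lambda>p. poly p x"] show ?case
      by (simp add: poly_sum)
  qed
  moreover have "((\<lambda>\<beta>. \<Sum>y\<in>real ` S. poly (Q \<beta> - P) y * poly (L y) x) \<longlongrightarrow> 0) F"
    using node by (intro tendsto_null_sum tendsto_mult_left_zero) auto
  ultimately have "((\<lambda>\<beta>. poly (Q \<beta> - P) x) \<longlongrightarrow> 0) F"
    by (rule Lim_transform_eventually[rotated])
  then show ?thesis
    by (simp add: LIM_zero_iff)
qed

text \<open>Each Pochhammer symbol alternates in sign with \<open>y\<close>; pairing their factors
  gives products of two negative numbers, since \<open>i < y \<le> N\<close>.\<close>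

lemma gen_krawtchouk_weight_pos:
  assumes "\<alpha> < - real N" "c > 0" "y \<le> N"
  shows "gen_krawtchouk_weight \<alpha> (- real N) c y > 0"
proof -
  have "pochhammer \<alpha> y * pochhammer (- real N) y = (\<Prod>i<y. (\<alpha> + real i) * (- real N + real i))"
    by (simp add: pochhammer_prod prod.distrib atLeast0LessThan)
  also have "\<dots> > 0"
    using assms by (intro prod_pos ballI mult_neg_neg) auto
  finally show ?thesis
    using assms(2) by (simp add: gen_krawtchouk_weight_def)
qed

text \<open>The power of \<beta> from \<open>c * \<beta>\<close> matches the growth of
  \<open>pochhammer (\<beta> + 1) y\<close> factor by factor.\<close>

lemma tendsto_gen_hahn_weight:
  "((\<lambda>\<beta>. gen_hahn_weight a b \<beta> (c * \<beta>) y) \<longlongrightarrow> gen_krawtchouk_weight a b c y) at_top"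
proof -
  have factor: "((\<lambda>\<beta>. \<beta> / (\<beta> + 1 + real i)) \<longlongrightarrow> 1) at_top" for i
    by real_asymp
  have "((\<lambda>\<beta>. gen_krawtchouk_weight a b c y * (\<Prod>i<y. \<beta> / (\<beta> + 1 + real i)))
      \<longlongrightarrow> gen_krawtchouk_weight a b c y * (\<Prod>i<y. 1)) at_top"
    by (intro tendsto_intros factor)
  \<comment> \<open>This holds for every real \<beta>: if some \<open>\<beta> + 1 + real i\<close>
    with \<open>i < y\<close> vanishes, division by zero makes both sides 0.\<close>
  moreover have "gen_hahn_weight a b \<beta> (c * \<beta>) y
      = gen_krawtchouk_weight a b c y * (\<Prod>i<y. \<beta> / (\<beta> + 1 + real i))" for \<beta>
    by (simp add: gen_hahn_weight_def gen_krawtchouk_weight_def pochhammer_prod prod_dividef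
        power_mult_distrib atLeast0LessThan mult_ac)
  ultimately show ?thesis by simp
qed

theorem mainTheorem2:
  fixes N n :: nat and \<alpha> c x :: real
    and P :: "nat \<Rightarrow> real poly"
    and Q :: "real \<Rightarrow> nat \<Rightarrow> real poly"
  assumes "\<alpha> < - real N" and "c > 0"
    and "\<And>m. m \<le> N \<Longrightarrow>
           monic_orthogonal_poly {0..N} (gen_krawtchouk_weight \<alpha> (- real N) c) m (P m)"
    and "\<And>\<beta> m. \<beta> > 0 \<Longrightarrow> m \<le> N \<Longrightarrow>
           monic_orthogonal_poly {0..N} (gen_hahn_weight \<alpha> (- real N) \<beta> (c * \<beta>)) m (Q \<beta> m)"
    and "n \<le> N"
  shows "((\<lambda>\<beta>. poly (Q \<beta> n) x) \<longlongrightarrow> poly (P n) x) at_top"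
proof (rule tendsto_monic_orthogonal_poly[where w = "gen_krawtchouk_weight \<alpha> (- real N) c"])
  show "\<forall>\<^sub>F \<beta> in at_top. monic_orthogonal_poly {0..N}
      (gen_hahn_weight \<alpha> (- real N) \<beta> (c * \<beta>)) n (Q \<beta> n)"
    \<comment> \<open>Orthogonality of \<open>Q \<beta> n\<close> is given only for \<beta> > 0,
      which holds eventually.\<close>
    using eventually_gt_at_top[of 0] by eventually_elim (intro assms(4) assms(5))
qed (use assms in \<open>auto intro: gen_krawtchouk_weight_pos tendsto_gen_hahn_weight\<close>)

end
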